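(* Let $X$ be a Hilbert space and let $J:X\to\mathbb{R}$ be first order differentiable, $\mu$-Polyak-Lojasiewicz and $L$-descent, with a minimizer $x^\star\in X$. Consider the inexact gradient iteration $$x^{(i+1)}=x^{(i)}-\kappa\big(\nabla J(x^{(i)})+\xi^{(i)}\big),\qquad i=0,\dots,k-1,$$ with starting point $x^{(0)}\in X$, constant step size $\kappa$, and gradient errors $\xi^{(i)}\in X$. Denote $\theta=1-\mu(2\kappa-L\kappa^2)$. (1) If $\kappa=1/L$ and $\epsilon$ is such that $\|\xi^{(i)}\|_X\le\epsilon$ for all $i=0,\dots,k-1$, then $$J(x^{(k)})-J(x^\star)\le\Big(1-\frac{\mu}{L}\Big)^k\big(J(x^{(0)})-J(x^\star)\big)+\frac{1}{2\mu}\Big(1-\Big(1-\frac{\mu}{L}\Big)^k\Big)\epsilon^2 .$$ (2) If $0<\kappa<1/L$, $0<\theta<1$, and $\epsilon$ is such that $\|\xi^{(i)}\|_X\le\epsilon<\frac{2-\kappa L}{4-\kappa L}\|\nabla J(x^{(i)})\|_X$ for all $i=0,\dots,k-1$, then $$J(x^{(k)})-J(x^\star)\le\theta^k\big(J(x^{(0)})-J(x^\star)\big)+\frac{1-\theta^k}{1-\theta}\Big(\sqrt{2L}\,|L\kappa^2-\kappa|\sqrt{J(x^{(0)})-J(x^\star)}\;\epsilon+\frac{L\kappa^2}{2}\epsilon^2\Big).$$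
   Context: $J'(x)$ is the derivative of $J$ at $x$, and $\nabla J(x)\in X$ is its Riesz representative: $\langle J'(x),y\rangle=(\nabla J(x),y)_X$ for all $y\in X$. $J$ is $L$-descent if $J(y)\le J(x)+\langle J'(x),y-x\rangle+\frac L2\|y-x\|_X^2$ for all $x,y\in X$. For a positive constant $\mu$, $J$ is $\mu$-Polyak-Lojasiewicz if it is bounded below and $J(x)-\inf_X J\le\frac{1}{2\mu}\|\nabla J(x)\|_X^2$ for all $x\in X$. Standing assumption: the computed gradient $\nabla J(x^{(i)})+\xi^{(i)}$ is never zero, so $x^{(i+1)}\ne x^{(i)}$.
   Formalization: Part (1) additionally assumes L ≠ 0 (so that 1/L is defined) and, only when J is constant, μ ≤ 2L; without the latter it fails, e.g. for X = R, J = 0, μ = 3, L = κ = ξ = ε = 1, k = 2, where the right side is −1/2. *)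

theory Defs
  imports "HOL-Analysis.Analysis"
begin

(* Riesz representative of the Frechet derivative. On a Hilbert space, at a point where J is
   differentiable, the representation theorem gives existence and uniqueness of the described
   vector; elsewhere the value is unspecified. *)
definition gradient :: "('a::{real_inner,complete_space} \<Rightarrow> real) \<Rightarrow> 'a \<Rightarrow> 'a" where
  "gradient J x = (THE g. \<forall>y. frechet_derivative J (at x) y = inner g y)"

definition L_descent :: "real \<Rightarrow> ('a::{real_inner,complete_space} \<Rightarrow> real) \<Rightarrow> bool" where
  "L_descent L J \<longleftrightarrow>
     (\<forall>x y. J y \<le> J x + frechet_derivative J (at x) (y - x) + L / 2 * (norm (y - x))\<^sup>2)"

(* bdd_below is a separate requirement because INF is unspecified on sets unbounded below. *)
definition polyak_lojasiewicz ::
  "real \<Rightarrow> ('a::{real_inner,complete_space} \<Rightarrow> real) \<Rightarrow> bool" where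
  "polyak_lojasiewicz \<mu> J \<longleftrightarrow>
     0 < \<mu> \<and> bdd_below (range J) \<and>
     (\<forall>x. J x - (INF y. J y) \<le> 1 / (2 * \<mu>) * (norm (gradient J x))\<^sup>2)"

end

theory Submission
  imports Defs
begin

text \<open>
  Write \<open>e i = J (x i) - J xstar\<close> and \<open>g = gradient J (x i)\<close>.  Inserting the step
  \<open>- \<kappa> *\<^sub>R (g + \<xi>)\<close> into the descent inequality and expanding the square gives
  \<open>e (Suc i) \<le> e i - (\<kappa> - L\<kappa>\<^sup>2/2) \<bar>g\<bar>\<^sup>2 + (L\<kappa>\<^sup>2 - \<kappa>) (g \<bullet> \<xi>) + (L\<kappa>\<^sup>2/2) \<bar>\<xi>\<bar>\<^sup>2\<close>
  (\<open>inexact_step_bound\<close>).  The Polyak-Lojasiewicz inequality \<open>\<bar>g\<bar>\<^sup>2 \<ge> 2\<mu> e i\<close> turns the second term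
  into a contraction of \<open>e i\<close> by the factor \<open>\<theta>\<close>, so that \<open>e (Suc i) \<le> \<theta> * e i + c\<close> as soon as the
  error terms are bounded by a constant \<open>c\<close>; summing the geometric series finishes the argument
  (\<open>affine_recursion_bound\<close>).

  For \<open>\<kappa> = 1/L\<close> the mixed term vanishes and \<open>c = \<epsilon>\<^sup>2/(2L)\<close>.  The recursion needs a nonnegative factor
  \<open>1 - \<mu>/L\<close>.  The descent inequality at \<open>x - g/L\<close> gives \<open>\<bar>g\<bar>\<^sup>2 \<le> 2L (J x - J xstar)\<close>
  (\<open>gradient_norm_le\<close>), which together with the Polyak-Lojasiewicz inequality forces
  \<open>\<mu> \<le> L\<close> unless \<open>J\<close> is constant.  For constant \<open>J\<close> the left-hand side is \<open>0\<close>, and \<open>\<mu> \<le> 2L\<close> yields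
  \<open>\<bar>1 - \<mu>/L\<bar> \<le> 1\<close>, hence a nonnegative right-hand side.

  For \<open>\<kappa> < 1/L\<close> the mixed term is at most \<open>\<bar>L\<kappa>\<^sup>2 - \<kappa>\<bar> \<bar>g\<bar> \<epsilon>\<close> with \<open>\<bar>g\<bar> \<le> sqrt (2L) * sqrt (e i)\<close>.
  To replace \<open>e i\<close> by \<open>e 0\<close> one needs that \<open>e\<close> does not increase; this holds because the error is
  smaller than the gradient, as \<open>(2 - \<kappa>L)/(4 - \<kappa>L) < 1\<close> (\<open>inexact_step_decreases\<close>).

  All of this uses that \<open>gradient J\<close> really represents the derivative, which is the Riesz
  representation theorem (\<open>riesz_representation\<close>).
\<close>

section \<open>Riesz representation of the derivative\<close>

text \<open>
  The representing vector is the minimizer of the energy \<open>\<phi> z = \<bar>z\<bar>\<^sup>2/2 - f z\<close>.  By the parallelogram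
  identity \<open>\<bar>a - b\<bar>\<^sup>2/4 = \<phi> a + \<phi> b - 2 * \<phi> ((a + b)/2)\<close> every minimizing sequence is Cauchy, and
  stationarity of \<open>\<phi>\<close> at its limit is the representation.
\<close>
lemma riesz_representation:
  fixes f :: "'a::{real_inner,complete_space} \<Rightarrow> real"
  assumes "bounded_linear f"
  shows "\<exists>g. \<forall>y. f y = inner g y"
proof -
  interpret bounded_linear f by fact
  define \<phi> where "\<phi> z = (norm z)\<^sup>2 / 2 - f z" for z
  define m where "m = (INF z. \<phi> z)"
  obtain K where K: "\<And>z. norm (f z) \<le> norm z * K"
    using bounded by blast
  have "- (K\<^sup>2 / 2) \<le> \<phi> z" for z
  proof -
    have "0 \<le> (norm z - K)\<^sup>2" by simp
    moreover have "f z \<le> norm z * K" using K[of z] by simp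
    ultimately show ?thesis unfolding \<phi>_def by (simp add: power2_eq_square algebra_simps)
  qed
  then have bdd: "bdd_below (range \<phi>)" by (intro bdd_belowI2)
  have m_le: "m \<le> \<phi> z" for z
    unfolding m_def using bdd by (simp add: cINF_lower)
  have parallelogram: "(norm (a - b))\<^sup>2 \<le> 4 * (\<phi> a - m) + 4 * (\<phi> b - m)" for a b
  proof -
    let ?h = "(1/2) *\<^sub>R (a + b)"
    have "f ?h = (f a + f b) / 2" by (simp add: add scaleR)
    moreover have "(norm ?h)\<^sup>2 = (norm (a + b))\<^sup>2 / 4"
      by (simp add: power_divide)
    moreover have "(norm (a + b))\<^sup>2 + (norm (a - b))\<^sup>2 = 2 * (norm a)\<^sup>2 + 2 * (norm b)\<^sup>2"
      by (simp add: power2_norm_eq_inner algebra_simps inner_commute)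
    ultimately have "(norm (a - b))\<^sup>2 = 4 * \<phi> a + 4 * \<phi> b - 8 * \<phi> ?h"
      unfolding \<phi>_def by simp
    then show ?thesis using m_le[of ?h] by simp
  qed
  have "\<exists>z. \<phi> z < m + inverse (real (Suc n))" for n
    using cINF_less_iff[OF _ bdd, of "m + inverse (real (Suc n))"] by (auto simp: m_def)
  then obtain z where z: "\<And>n. \<phi> (z n) < m + inverse (real (Suc n))" by metis
  have "Cauchy z"
  proof (rule metric_CauchyI)
    fix r :: real assume r: "0 < r"
    then obtain N where N: "inverse (real (Suc N)) < r\<^sup>2 / 8"
      using reals_Archimedean[of "r\<^sup>2 / 8"] by auto
    have close: "\<phi> (z n) - m < r\<^sup>2 / 8" if "N \<le> n" for n
    proof -
      have "inverse (real (Suc n)) \<le> inverse (real (Suc N))" using that by simp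
      then show ?thesis using z[of n] N by linarith
    qed
    have "dist (z i) (z j) < r" if "N \<le> i" "N \<le> j" for i j
    proof -
      have "(norm (z i - z j))\<^sup>2 < r\<^sup>2"
        using parallelogram[of "z i" "z j"] close[OF that(1)] close[OF that(2)]
        by (simp add: field_simps)
      then show ?thesis using r by (simp add: dist_norm power2_less_imp_less)
    qed
    then show "\<exists>N. \<forall>i\<ge>N. \<forall>j\<ge>N. dist (z i) (z j) < r" by blast
  qed
  then obtain g where g: "z \<longlonglongrightarrow> g"
    using Cauchy_convergent convergent_def by blast
  have "(\<lambda>n. \<phi> (z n)) \<longlonglongrightarrow> \<phi> g"
    unfolding \<phi>_def using g by (intro tendsto_intros tendsto) auto
  moreover have "(\<lambda>n. m + inverse (real (Suc n))) \<longlonglongrightarrow> m + 0"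
    by (intro tendsto_intros LIMSEQ_inverse_real_of_nat)
  ultimately have "\<phi> g \<le> m + 0"
    using z by (intro LIMSEQ_le) (auto intro: less_imp_le)
  then have min: "\<phi> g \<le> \<phi> y" for y using m_le[of y] by simp
  have "f y = inner g y" for y
  proof (cases "y = 0")
    case True then show ?thesis by (simp add: zero)
  next
    case False
    define c s where "c = inner g y - f y" and "s = (norm y)\<^sup>2"
    have s: "0 < s" using False by (simp add: s_def)
    \<comment> \<open>The \<open>t\<close> below minimizes the quadratic \<open>t \<mapsto> \<phi> (g + t *\<^sub>R y) = \<phi> g + t * c + t\<^sup>2 * s / 2\<close>.\<close>
    define t where "t = - c / s"
    have "(norm (g + t *\<^sub>R y))\<^sup>2 = (norm g)\<^sup>2 + 2 * t * inner g y + t\<^sup>2 * s"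
      unfolding s_def power2_norm_eq_inner
      by (simp add: algebra_simps inner_commute power2_eq_square)
    then have "\<phi> (g + t *\<^sub>R y) = \<phi> g + t * c + t\<^sup>2 * s / 2"
      unfolding \<phi>_def c_def by (simp add: add scaleR algebra_simps)
    moreover have "t * c + t\<^sup>2 * s / 2 = - (c\<^sup>2 / (2 * s))"
      unfolding t_def using s by (simp add: field_simps power2_eq_square)
    ultimately have "c\<^sup>2 / (2 * s) \<le> 0"
      using min[of "g + t *\<^sub>R y"] by linarith
    then have "c\<^sup>2 \<le> 0" using s by (simp add: divide_le_0_iff)
    then show ?thesis by (simp add: c_def)
  qed
  then show ?thesis by blast
qed

lemma frechet_derivative_eq_inner_gradient:
  assumes "J differentiable (at x)"
  shows "frechet_derivative J (at x) y = inner (gradient J x) y"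
proof -
  have "bounded_linear (frechet_derivative J (at x))"
    using assms frechet_derivative_works has_derivative_bounded_linear by blast
  then obtain g where g: "\<forall>y. frechet_derivative J (at x) y = inner g y"
    using riesz_representation by blast
  have "\<forall>y. frechet_derivative J (at x) y = inner (gradient J x) y"
    unfolding gradient_def
  proof (rule theI)
    fix h assume "\<forall>y. frechet_derivative J (at x) y = inner h y"
    then show "h = g" using g by (metis vector_eq_rdot)
  qed (rule g)
  then show ?thesis by blast
qed

section \<open>Consequences of the descent inequality\<close>

lemma L_descent_gradient:
  assumes "\<And>z. J differentiable (at z)" and "L_descent L J"
  shows "J (x + d) \<le> J x + inner (gradient J x) d + L / 2 * (norm d)\<^sup>2"
proof -
  have "J (x + d) \<le> J x + frechet_derivative J (at x) (x + d - x) + L / 2 * (norm (x + d - x))\<^sup>2"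
    using assms(2) unfolding L_descent_def by blast
  then show ?thesis by (simp add: frechet_derivative_eq_inner_gradient assms(1))
qed

lemma gradient_minimizer_eq_0:
  assumes "\<And>z. J differentiable (at z)" and "\<And>z. J xstar \<le> J z"
  shows "gradient J xstar = 0"
proof -
  have "(J has_derivative frechet_derivative J (at xstar)) (at xstar)"
    using assms(1) frechet_derivative_works by blast
  then have "frechet_derivative J (at xstar) = (\<lambda>v. 0)"
    using assms(2) by (intro differential_zero_maxmin[of xstar UNIV]) auto
  then have "inner (gradient J xstar) (gradient J xstar) = 0"
    by (metis frechet_derivative_eq_inner_gradient assms(1))
  then show ?thesis by simp
qed

text \<open>
  The quadratic upper bound is minimized at \<open>d = - gradient J x / L\<close>, where its value
  \<open>J x - \<bar>gradient J x\<bar>\<^sup>2/(2L)\<close> still cannot drop below the minimum of \<open>J\<close>.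
\<close>
lemma gradient_norm_le:
  assumes "\<And>z. J differentiable (at z)" and "L_descent L J"
    and "\<And>z. J xstar \<le> J z" and "0 < L"
  shows "(norm (gradient J x))\<^sup>2 \<le> 2 * L * (J x - J xstar)"
proof -
  let ?g = "gradient J x"
  have "J xstar \<le> J (x + (- 1 / L) *\<^sub>R ?g)" by (rule assms(3))
  also have "\<dots> \<le> J x + inner ?g ((- 1 / L) *\<^sub>R ?g) + L / 2 * (norm ((- 1 / L) *\<^sub>R ?g))\<^sup>2"
    by (rule L_descent_gradient[OF assms(1,2)])
  also have "\<dots> = J x - (norm ?g)\<^sup>2 / (2 * L)"
    using assms(4) by (simp add: power2_norm_eq_inner[symmetric] power_divide field_simps power2_eq_square)
  finally show ?thesis using assms(4) by (simp add: field_simps)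
qed

text \<open>
  A concave quadratic upper bound with vanishing gradient at the minimizer leaves no room above
  the minimum.
\<close>
lemma L_descent_nonpos_imp_constant:
  assumes "\<And>z. J differentiable (at z)" and "L_descent L J"
    and "\<And>z. J xstar \<le> J z" and "L \<le> 0"
  shows "J z = J xstar"
proof -
  have "J (xstar + (z - xstar)) \<le> J xstar + L / 2 * (norm (z - xstar))\<^sup>2"
    using L_descent_gradient[OF assms(1,2), of xstar "z - xstar"]
      gradient_minimizer_eq_0[OF assms(1,3)] by simp
  moreover have "L / 2 * (norm (z - xstar))\<^sup>2 \<le> 0"
    using assms(4) by (simp add: mult_le_0_iff)
  ultimately show ?thesis using assms(3)[of z] by simp
qed

lemma polyak_lojasiewicz_minimizer:
  assumes "polyak_lojasiewicz \<mu> J" and "\<And>z. J xstar \<le> J z"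
  shows "2 * \<mu> * (J x - J xstar) \<le> (norm (gradient J x))\<^sup>2"
proof -
  have "(INF y. J y) = J xstar"
    using assms(2) by (intro cInf_eq_minimum) auto
  then have "J x - J xstar \<le> 1 / (2 * \<mu>) * (norm (gradient J x))\<^sup>2" and "0 < \<mu>"
    using assms(1) unfolding polyak_lojasiewicz_def by auto
  then show ?thesis by (simp add: field_simps)
qed

text \<open>
  The squared gradient norm lies between \<open>2\<mu>\<close> and \<open>2L\<close> times the excess of \<open>J\<close> over its minimum;
  the two factors can be compared wherever this excess is positive.
\<close>
lemma polyak_lojasiewicz_le_L:
  assumes "\<And>z. J differentiable (at z)" and "polyak_lojasiewicz \<mu> J" and "L_descent L J"
    and "\<And>z. J xstar \<le> J z" and "0 < L" and "J z \<noteq> J xstar"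
  shows "\<mu> \<le> L"
proof -
  have "2 * \<mu> * (J z - J xstar) \<le> 2 * L * (J z - J xstar)"
    using polyak_lojasiewicz_minimizer[OF assms(2,4), of z]
      gradient_norm_le[OF assms(1,3,4,5), of z] by linarith
  moreover have "0 < J z - J xstar" using assms(4)[of z] assms(6) by simp
  ultimately show ?thesis by simp
qed

section \<open>One inexact gradient step\<close>

lemma inexact_step_bound:
  assumes "\<And>z. J differentiable (at z)" and "L_descent L J"
  shows "J (x - \<kappa> *\<^sub>R (gradient J x + \<xi>)) \<le>
    J x - (\<kappa> - L * \<kappa>\<^sup>2 / 2) * (norm (gradient J x))\<^sup>2
      + (L * \<kappa>\<^sup>2 - \<kappa>) * inner (gradient J x) \<xi> + L * \<kappa>\<^sup>2 / 2 * (norm \<xi>)\<^sup>2"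
proof -
  let ?g = "gradient J x" and ?d = "- (\<kappa> *\<^sub>R (gradient J x + \<xi>))"
  have "inner ?g ?d = - \<kappa> * (norm ?g)\<^sup>2 - \<kappa> * inner ?g \<xi>"
    by (simp add: power2_norm_eq_inner algebra_simps)
  moreover have "(norm ?d)\<^sup>2 = \<kappa>\<^sup>2 * (norm (?g + \<xi>))\<^sup>2"
    by (simp add: power_mult_distrib)
  moreover have "(norm (?g + \<xi>))\<^sup>2 = (norm ?g)\<^sup>2 + 2 * inner ?g \<xi> + (norm \<xi>)\<^sup>2"
    by (simp add: power2_norm_eq_inner algebra_simps inner_commute)
  ultimately show ?thesis
    using L_descent_gradient[OF assms, of x ?d]
    by (simp add: algebra_simps flip: power2_norm_eq_inner)
qed

text \<open>
  For \<open>\<kappa> \<le> 1/L\<close> the coefficient of the mixed term is nonpositive, so that term is worst when the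
  error points against the gradient; Cauchy-Schwarz then leaves only norms.
\<close>
lemma inexact_step_bound_norm:
  assumes "\<And>z. J differentiable (at z)" and "L_descent L J"
    and "0 < \<kappa>" and "0 < L" and "\<kappa> * L \<le> 1" and "norm \<xi> \<le> \<epsilon>"
  shows "J (x - \<kappa> *\<^sub>R (gradient J x + \<xi>)) \<le>
    J x - (\<kappa> - L * \<kappa>\<^sup>2 / 2) * (norm (gradient J x))\<^sup>2
      + (\<kappa> - L * \<kappa>\<^sup>2) * norm (gradient J x) * \<epsilon> + L * \<kappa>\<^sup>2 / 2 * \<epsilon>\<^sup>2"
proof -
  let ?g = "gradient J x"
  have coeff: "0 \<le> \<kappa> - L * \<kappa>\<^sup>2"
    using mult_left_mono[OF assms(5), of \<kappa>] assms(3) by (simp add: power2_eq_square algebra_simps)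
  have "- inner ?g \<xi> \<le> norm ?g * norm \<xi>"
    using Cauchy_Schwarz_ineq2[of ?g \<xi>] by linarith
  also have "\<dots> \<le> norm ?g * \<epsilon>" using assms(6) by (intro mult_left_mono) auto
  finally have "(\<kappa> - L * \<kappa>\<^sup>2) * (- inner ?g \<xi>) \<le> (\<kappa> - L * \<kappa>\<^sup>2) * (norm ?g * \<epsilon>)"
    using coeff by (rule mult_left_mono)
  moreover have "L * \<kappa>\<^sup>2 / 2 * (norm \<xi>)\<^sup>2 \<le> L * \<kappa>\<^sup>2 / 2 * \<epsilon>\<^sup>2"
    using assms(4,6) by (intro mult_left_mono power_mono) auto
  ultimately show ?thesis
    using inexact_step_bound[OF assms(1,2), of x \<kappa> \<xi>] by (simp add: algebra_simps)
qed

text \<open>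
  For \<open>\<epsilon> = \<bar>gradient J x\<bar>\<close> the error terms of the norm bound exactly cancel the guaranteed decrease.
\<close>
lemma inexact_step_decreases:
  assumes "\<And>z. J differentiable (at z)" and "L_descent L J"
    and "0 < \<kappa>" and "0 < L" and "\<kappa> * L \<le> 1" and "norm \<xi> \<le> norm (gradient J x)"
  shows "J (x - \<kappa> *\<^sub>R (gradient J x + \<xi>)) \<le> J x"
  using inexact_step_bound_norm[OF assms, of x]
  by (simp add: power2_eq_square algebra_simps)

section \<open>Accumulation of the errors\<close>

lemma affine_recursion_bound:
  fixes e :: "nat \<Rightarrow> real"
  assumes "\<And>i. i < k \<Longrightarrow> e (Suc i) \<le> q * e i + c" and "0 \<le> q" and "q \<noteq> 1"
  shows "e k \<le> q ^ k * e 0 + (1 - q ^ k) / (1 - q) * c"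
  using assms(1)
proof (induction k)
  case 0
  then show ?case by simp
next
  case (Suc k)
  have "e (Suc k) \<le> q * e k + c" using Suc.prems by simp
  also have "\<dots> \<le> q * (q ^ k * e 0 + (1 - q ^ k) / (1 - q) * c) + c"
    using Suc assms(2) by (intro add_right_mono mult_left_mono) auto
  also have "\<dots> = q ^ Suc k * e 0 + (1 - q ^ Suc k) / (1 - q) * c"
    using assms(3) by (simp add: field_simps)
  finally show ?case .
qed

text \<open>
  For \<open>\<kappa> = 1/L\<close> the mixed term drops out of the step bound, so the only error per step is
  \<open>\<epsilon>\<^sup>2/(2L)\<close>, and \<open>1 - q = \<mu>/L\<close> turns the geometric sum into the factor \<open>1/(2\<mu>)\<close>.
\<close>
lemma inexact_gradient_descent_full_step:
  fixes J :: "'a::{real_inner,complete_space} \<Rightarrow> real"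
  assumes differentiable: "\<And>z. J differentiable (at z)"
    and pl: "polyak_lojasiewicz \<mu> J"
    and descent: "L_descent L J"
    and minimizer: "\<And>z. J xstar \<le> J z"
    and iteration: "\<And>i. i < k \<Longrightarrow> x (Suc i) = x i - (1 / L) *\<^sub>R (gradient J (x i) + \<xi> i)"
    and const: "J constant_on UNIV \<Longrightarrow> \<mu> \<le> 2 * L"
    and err: "\<And>i. i < k \<Longrightarrow> norm (\<xi> i) \<le> \<epsilon>"
  shows "J (x k) - J xstar \<le>
    (1 - \<mu> / L) ^ k * (J (x 0) - J xstar) + 1 / (2 * \<mu>) * (1 - (1 - \<mu> / L) ^ k) * \<epsilon>\<^sup>2"
proof -
  have \<mu>: "0 < \<mu>" using pl by (simp add: polyak_lojasiewicz_def)
  show ?thesis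
  proof (cases "\<forall>z. J z = J xstar")
    case True
    then have "\<mu> \<le> 2 * L" using const by (auto simp: constant_on_def)
    then have "\<bar>1 - \<mu> / L\<bar> \<le> 1" using \<mu> by (simp add: abs_le_iff field_simps)
    then have "\<bar>1 - \<mu> / L\<bar> ^ k \<le> 1" by (simp add: power_le_one)
    then have "(1 - \<mu> / L) ^ k \<le> 1" by (metis abs_le_D1 power_abs)
    then have "0 \<le> 1 / (2 * \<mu>) * (1 - (1 - \<mu> / L) ^ k) * \<epsilon>\<^sup>2"
      using \<mu> by (intro mult_nonneg_nonneg) auto
    moreover have "J (x k) = J xstar" and "J (x 0) = J xstar" using True by blast+
    ultimately show ?thesis by simp
  next
    case False
    then obtain z where z: "J z \<noteq> J xstar" by blast
    then have L: "0 < L"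
      using L_descent_nonpos_imp_constant[OF differentiable descent minimizer] by force
    have "\<mu> \<le> L"
      by (rule polyak_lojasiewicz_le_L[OF differentiable pl descent minimizer L z])
    define q where "q = 1 - \<mu> / L"
    have q: "0 \<le> q" "q \<noteq> 1" using \<open>\<mu> \<le> L\<close> L \<mu> by (auto simp: q_def field_simps)
    have step: "J (x (Suc i)) - J xstar \<le> q * (J (x i) - J xstar) + \<epsilon>\<^sup>2 / (2 * L)" if "i < k" for i
    proof -
      have "J (x (Suc i)) \<le> J (x i) - (norm (gradient J (x i)))\<^sup>2 / (2 * L) + \<epsilon>\<^sup>2 / (2 * L)"
        using inexact_step_bound_norm[OF differentiable descent, of "1 / L" "\<xi> i" \<epsilon> "x i"]
          L err[OF that]
        unfolding iteration[OF that] by (simp add: power2_eq_square field_simps)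
      moreover have "2 * \<mu> * (J (x i) - J xstar) / (2 * L) \<le> (norm (gradient J (x i)))\<^sup>2 / (2 * L)"
        using polyak_lojasiewicz_minimizer[OF pl minimizer] L by (intro divide_right_mono) auto
      moreover have "q * (J (x i) - J xstar) =
          J (x i) - J xstar - 2 * \<mu> * (J (x i) - J xstar) / (2 * L)"
        unfolding q_def using L by (simp add: field_simps)
      ultimately show ?thesis by linarith
    qed
    have "J (x k) - J xstar \<le> q ^ k * (J (x 0) - J xstar) + (1 - q ^ k) / (1 - q) * (\<epsilon>\<^sup>2 / (2 * L))"
      by (rule affine_recursion_bound[where e = "\<lambda>i. J (x i) - J xstar", OF step q])
    also have "(1 - q ^ k) / (1 - q) * (\<epsilon>\<^sup>2 / (2 * L)) = 1 / (2 * \<mu>) * (1 - q ^ k) * \<epsilon>\<^sup>2"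
    proof -
      have "1 - q = \<mu> / L" by (simp add: q_def)
      then show ?thesis using L \<mu> by (simp add: field_simps)
    qed
    finally show ?thesis by (simp add: q_def)
  qed
qed

text \<open>
  Since the errors are dominated by the gradients, the values along the iteration never exceed the
  initial one.  The gradient norms are thus bounded uniformly by \<open>sqrt (2L (J (x 0) - J xstar))\<close>,
  which makes the mixed error term a constant in the recursion.
\<close>
lemma inexact_gradient_descent_short_step:
  fixes J :: "'a::{real_inner,complete_space} \<Rightarrow> real"
  assumes differentiable: "\<And>z. J differentiable (at z)"
    and pl: "polyak_lojasiewicz \<mu> J"
    and descent: "L_descent L J"
    and minimizer: "\<And>z. J xstar \<le> J z"
    and iteration: "\<And>i. i < k \<Longrightarrow> x (Suc i) = x i - \<kappa> *\<^sub>R (gradient J (x i) + \<xi> i)"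
    and \<kappa>: "0 < \<kappa>" and L: "0 < L" and \<kappa>L: "\<kappa> * L \<le> 1"
    and theta: "\<theta> = 1 - \<mu> * (2 * \<kappa> - L * \<kappa>\<^sup>2)" "0 \<le> \<theta>" "\<theta> \<noteq> 1"
    and err: "\<And>i. i < k \<Longrightarrow> norm (\<xi> i) \<le> \<epsilon>"
    and err_grad: "\<And>i. i < k \<Longrightarrow> \<epsilon> \<le> norm (gradient J (x i))"
  shows "J (x k) - J xstar \<le>
    \<theta> ^ k * (J (x 0) - J xstar) +
    (1 - \<theta> ^ k) / (1 - \<theta>) *
      (sqrt (2 * L) * \<bar>L * \<kappa>\<^sup>2 - \<kappa>\<bar> * sqrt (J (x 0) - J xstar) * \<epsilon> + L * \<kappa>\<^sup>2 / 2 * \<epsilon>\<^sup>2)"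
proof -
  have "\<kappa> * (\<kappa> * L) \<le> \<kappa> * 1" using \<kappa>L \<kappa> by (intro mult_left_mono) auto
  then have mixed_coeff: "L * \<kappa>\<^sup>2 \<le> \<kappa>" by (simp add: power2_eq_square algebra_simps)
  have decrease: "J (x (Suc i)) \<le> J (x i)" if "i < k" for i
    unfolding iteration[OF that]
    using err[OF that] err_grad[OF that]
    by (intro inexact_step_decreases[OF differentiable descent \<kappa> L \<kappa>L]) simp
  have le_initial: "J (x i) \<le> J (x 0)" if "i \<le> k" for i
    using that
  proof (induction i)
    case (Suc i)
    then show ?case using decrease[of i] by simp
  qed simp
  let ?c = "sqrt (2 * L) * \<bar>L * \<kappa>\<^sup>2 - \<kappa>\<bar> * sqrt (J (x 0) - J xstar) * \<epsilon> + L * \<kappa>\<^sup>2 / 2 * \<epsilon>\<^sup>2"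
  have step: "J (x (Suc i)) - J xstar \<le> \<theta> * (J (x i) - J xstar) + ?c" if i: "i < k" for i
  proof -
    let ?g = "gradient J (x i)"
    have "0 \<le> \<epsilon>" using err[OF i] norm_ge_zero order_trans by blast
    have "(norm ?g)\<^sup>2 \<le> 2 * L * (J (x i) - J xstar)"
      by (rule gradient_norm_le[OF differentiable descent minimizer L])
    also have "\<dots> \<le> 2 * L * (J (x 0) - J xstar)"
      using le_initial[of i] i L by simp
    finally have "norm ?g \<le> sqrt (2 * L) * sqrt (J (x 0) - J xstar)"
      by (simp add: real_le_rsqrt flip: real_sqrt_mult)
    then have "(\<kappa> - L * \<kappa>\<^sup>2) * norm ?g * \<epsilon>
        \<le> (\<kappa> - L * \<kappa>\<^sup>2) * (sqrt (2 * L) * sqrt (J (x 0) - J xstar)) * \<epsilon>"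
      using mixed_coeff \<open>0 \<le> \<epsilon>\<close> by (intro mult_right_mono mult_left_mono) auto
    also have "\<dots> = sqrt (2 * L) * \<bar>L * \<kappa>\<^sup>2 - \<kappa>\<bar> * sqrt (J (x 0) - J xstar) * \<epsilon>"
      using mixed_coeff by simp
    finally have mixed: "(\<kappa> - L * \<kappa>\<^sup>2) * norm ?g * \<epsilon> \<le> \<dots>" .
    have "(\<kappa> - L * \<kappa>\<^sup>2 / 2) * (2 * \<mu> * (J (x i) - J xstar)) \<le> (\<kappa> - L * \<kappa>\<^sup>2 / 2) * (norm ?g)\<^sup>2"
      using polyak_lojasiewicz_minimizer[OF pl minimizer] mixed_coeff \<kappa> by (intro mult_left_mono) auto
    moreover have "\<theta> * (J (x i) - J xstar) =
        J (x i) - J xstar - (\<kappa> - L * \<kappa>\<^sup>2 / 2) * (2 * \<mu> * (J (x i) - J xstar))"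
      unfolding theta(1) by (simp add: algebra_simps)
    moreover note inexact_step_bound_norm[OF differentiable descent \<kappa> L \<kappa>L err[OF i], of "x i"]
    ultimately show ?thesis using mixed unfolding iteration[OF i] by linarith
  qed
  show ?thesis
    by (rule affine_recursion_bound[where e = "\<lambda>i. J (x i) - J xstar", OF step theta(2,3)])
qed

section \<open>Convergence of inexact gradient descent\<close>

theorem theorem12:
  fixes J :: "'a::{real_inner,complete_space} \<Rightarrow> real"
    and x \<xi> :: "nat \<Rightarrow> 'a" and xstar :: 'a
    and \<mu> L \<kappa> \<theta> \<epsilon> :: real and k :: nat
  assumes differentiable: "\<And>z. J differentiable (at z)"
    and pl: "polyak_lojasiewicz \<mu> J"
    and descent: "L_descent L J"
    and minimizer: "\<And>z. J xstar \<le> J z"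
    and iteration: "\<And>i. i < k \<Longrightarrow> x (Suc i) = x i - \<kappa> *\<^sub>R (gradient J (x i) + \<xi> i)"
    and nonzero: "\<And>i. i < k \<Longrightarrow> gradient J (x i) + \<xi> i \<noteq> 0"
    and theta: "\<theta> = 1 - \<mu> * (2 * \<kappa> - L * \<kappa>\<^sup>2)"
  shows
    "(L \<noteq> 0 \<and> \<kappa> = 1 / L \<and> (J constant_on UNIV \<longrightarrow> \<mu> \<le> 2 * L) \<and> (\<forall>i<k. norm (\<xi> i) \<le> \<epsilon>) \<longrightarrow>
        J (x k) - J xstar \<le>
          (1 - \<mu> / L) ^ k * (J (x 0) - J xstar) + 1 / (2 * \<mu>) * (1 - (1 - \<mu> / L) ^ k) * \<epsilon>\<^sup>2) \<and>
     (0 < \<kappa> \<and> \<kappa> < 1 / L \<and> 0 < \<theta> \<and> \<theta> < 1 \<and>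
        (\<forall>i<k. norm (\<xi> i) \<le> \<epsilon> \<and>
               \<epsilon> < (2 - \<kappa> * L) / (4 - \<kappa> * L) * norm (gradient J (x i))) \<longrightarrow>
        J (x k) - J xstar \<le>
          \<theta> ^ k * (J (x 0) - J xstar) +
          (1 - \<theta> ^ k) / (1 - \<theta>) *
            (sqrt (2 * L) * \<bar>L * \<kappa>\<^sup>2 - \<kappa>\<bar> * sqrt (J (x 0) - J xstar) * \<epsilon> +
             L * \<kappa>\<^sup>2 / 2 * \<epsilon>\<^sup>2))"
proof (intro conjI impI; elim conjE)
  assume "\<kappa> = 1 / L" and "J constant_on UNIV \<longrightarrow> \<mu> \<le> 2 * L" and "\<forall>i<k. norm (\<xi> i) \<le> \<epsilon>"
  then show "J (x k) - J xstar \<le>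
      (1 - \<mu> / L) ^ k * (J (x 0) - J xstar) + 1 / (2 * \<mu>) * (1 - (1 - \<mu> / L) ^ k) * \<epsilon>\<^sup>2"
    using iteration
    by (intro inexact_gradient_descent_full_step[OF differentiable pl descent minimizer]) auto
next
  assume \<kappa>: "0 < \<kappa>" "\<kappa> < 1 / L" and \<theta>: "0 < \<theta>" "\<theta> < 1"
    and err: "\<forall>i<k. norm (\<xi> i) \<le> \<epsilon> \<and>
      \<epsilon> < (2 - \<kappa> * L) / (4 - \<kappa> * L) * norm (gradient J (x i))"
  have L: "0 < L" using \<kappa> by (metis less_trans zero_less_divide_1_iff)
  then have \<kappa>L: "\<kappa> * L < 1" using \<kappa>(2) by (simp add: field_simps)
  have "(2 - \<kappa> * L) / (4 - \<kappa> * L) \<le> 1" using \<kappa>L by simp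
  then have "(2 - \<kappa> * L) / (4 - \<kappa> * L) * norm (gradient J (x i)) \<le> norm (gradient J (x i))" for i
    by (metis mult_right_mono mult_1 norm_ge_zero)
  then have "\<epsilon> \<le> norm (gradient J (x i))" if "i < k" for i
    using err that by (meson less_imp_le order_trans)
  then show "J (x k) - J xstar \<le>
      \<theta> ^ k * (J (x 0) - J xstar) +
      (1 - \<theta> ^ k) / (1 - \<theta>) *
        (sqrt (2 * L) * \<bar>L * \<kappa>\<^sup>2 - \<kappa>\<bar> * sqrt (J (x 0) - J xstar) * \<epsilon> + L * \<kappa>\<^sup>2 / 2 * \<epsilon>\<^sup>2)"
    using \<kappa>(1) L \<kappa>L \<theta> err
    by (intro inexact_gradient_descent_short_step[where x = x and \<xi> = \<xi>,
          OF differentiable pl descent minimizer iteration])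
      (auto simp: theta)
qed

end
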